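(* Let $n\ge 2$ and let $\mathcal P_n\subset[0,1]^2$ be an integration lattice with $n$ points. If $\operatorname{disp}(\mathcal P_n)=2/n$, then at least one of the following holds for some integer $m\ge 3$: (i) $n=F_m$ is a Fibonacci number and $\mathcal P_n$ is torus symmetric to the Fibonacci lattice $\mathcal F_m$; or (ii) $n=2F_m$ is twice a Fibonacci number and $\mathcal P_n$ is torus symmetric to the integration lattice with $n$ points and generator $q=2F_{m-2}$.
   Context: Fibonacci numbers: $F_1=F_2=1$ and $F_{m+2}=F_m+F_{m+1}$ for $m\ge 1$. For real $\alpha$, $\{\alpha\}$ is its fractional part. For integers $n$ and $1\le q<n$, the integration lattice with $n$ points and generator $q$ is $\big\{\big(\tfrac{k}{n},\{\tfrac{kq}{n}\}\big):k\in\{0,1,\dots,n-1\}\big\}$; $q$ is not required to be coprime to $n$. The Fibonacci lattice $\mathcal F_m$ is the integration lattice with $n=F_m$ points and generator $q=F_{m-2}$. The two-dimensional torus is identified with $[0,1]^2$ (opposite sides identified). For $a,b\in[0,1]$ let $I(a,b)=[a,b]$ if $a\le b$, and $I(a,b)=[0,b]\cup[a,1]$ if $a>b$ (a wrapped-around interval). For $x=(x_1,x_2),y=(y_1,y_2)\in[0,1]^2$ the periodic rectangle is $B(x,y)=I(x_1,y_1)\times I(x_2,y_2)$. For a finite point set $\mathcal P\subset[0,1]^2$, the (periodic) dispersion $\operatorname{disp}(\mathcal P)$ is the area of the largest periodic rectangle $B(x,y)$ containing no point of $\mathcal P$ in its interior (interior taken in the torus), i.e. the supremum of the areas of all such rectangles.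 Two point sets are torus symmetric if one is the image of the other under a composition of torus symmetries: translations modulo $1$, coordinate reflections $x_i\mapsto 1-x_i$ modulo $1$, and interchange of the two coordinates. *)

theory Defs
  imports "HOL-Analysis.Analysis" "HOL-Number_Theory.Fib"
begin

definition integration_lattice :: "nat \<Rightarrow> nat \<Rightarrow> (real \<times> real) set" where
  "integration_lattice n q = (\<lambda>k. (real k / real n, frac (real (k * q) / real n))) ` {0..<n}"

text \<open>Used for \<open>m \<ge> 3\<close> only, where \<open>1 \<le> fib (m - 2) < fib m\<close>.\<close>

definition fibonacci_lattice :: "nat \<Rightarrow> (real \<times> real) set" where
  "fibonacci_lattice m = integration_lattice (fib m) (fib (m - 2))"

text \<open>The torus is represented by the points of \<open>[0,1)\<^sup>2\<close>; \<open>torus_proj\<close> sends a point of the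
  plane (in particular of \<open>[0,1]\<^sup>2\<close>) to its representative modulo 1 in both coordinates.\<close>

definition torus_proj :: "real \<times> real \<Rightarrow> real \<times> real" where
  "torus_proj z = (frac (fst z), frac (snd z))"

definition torus_topology :: "(real \<times> real) topology" where
  "torus_topology = topology (\<lambda>U. U \<subseteq> range torus_proj \<and> open (torus_proj -` U))"

text \<open>\<open>torus_topology\<close> is the quotient topology induced by \<open>torus_proj\<close>.\<close>

lemma openin_torus_topology:
  "openin torus_topology U \<longleftrightarrow> U \<subseteq> range torus_proj \<and> open (torus_proj -` U)"
proof -
  have "istopology (\<lambda>U. U \<subseteq> range torus_proj \<and> open (torus_proj -` U))"
    unfolding istopology_def by (auto simp: vimage_Union intro!: open_Int open_UN)
  then show ?thesis
    by (simp add: torus_topology_def topology_inverse')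
qed

lemma topspace_torus_topology: "topspace torus_topology = range torus_proj"
proof
  show "topspace torus_topology \<subseteq> range torus_proj"
    unfolding topspace_def by (auto simp: openin_torus_topology)
  have "torus_proj -` range torus_proj = UNIV"
    by auto
  then have "openin torus_topology (range torus_proj)"
    by (simp add: openin_torus_topology)
  then show "range torus_proj \<subseteq> topspace torus_topology"
    by (rule openin_subset)
qed

lemma quotient_map_torus_proj: "quotient_map euclidean torus_topology torus_proj"
  unfolding quotient_map_def topspace_torus_topology
  by (auto simp: openin_torus_topology vimage_def)

lemma range_torus_proj: "range torus_proj = {0..<1} \<times> {0..<1}"
proof
  show "range torus_proj \<subseteq> {0..<1} \<times> {0..<1}"
    by (auto simp: torus_proj_def frac_lt_1)
  have "z \<in> range torus_proj" if "z \<in> {0..<1} \<times> {0..<1}" for z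
  proof -
    have "torus_proj z = z"
      using that by (auto simp: torus_proj_def frac_eq)
    then show ?thesis
      by (metis rangeI)
  qed
  then show "{0..<1} \<times> {0..<1} \<subseteq> range torus_proj"
    by blast
qed

definition periodic_interval :: "real \<Rightarrow> real \<Rightarrow> real set" where
  "periodic_interval a b = (if a \<le> b then {a..b} else {0..b} \<union> {a..1})"

definition periodic_rectangle :: "real \<times> real \<Rightarrow> real \<times> real \<Rightarrow> (real \<times> real) set" where
  "periodic_rectangle x y =
     periodic_interval (fst x) (fst y) \<times> periodic_interval (snd x) (snd y)"

definition torus_interior :: "(real \<times> real) set \<Rightarrow> (real \<times> real) set" where
  "torus_interior S = torus_topology interior_of (torus_proj ` S)"

definition dispersion :: "(real \<times> real) set \<Rightarrow> real" where
  "dispersion P = Sup {measure lborel (periodic_rectangle x y) | x y.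
     x \<in> {0..1} \<times> {0..1} \<and> y \<in> {0..1} \<times> {0..1} \<and>
     torus_interior (periodic_rectangle x y) \<inter> torus_proj ` P = {}}"

inductive torus_symmetry :: "(real \<times> real \<Rightarrow> real \<times> real) \<Rightarrow> bool" where
  translation: "torus_symmetry (\<lambda>(x1, x2). torus_proj (x1 + t1, x2 + t2))"
| reflection_fst: "torus_symmetry (\<lambda>(x1, x2). torus_proj (1 - x1, x2))"
| reflection_snd: "torus_symmetry (\<lambda>(x1, x2). torus_proj (x1, 1 - x2))"
| interchange: "torus_symmetry (\<lambda>(x1, x2). torus_proj (x2, x1))"
| composition: "torus_symmetry f \<Longrightarrow> torus_symmetry g \<Longrightarrow> torus_symmetry (f \<circ> g)"

text \<open>One direction suffices, since on the torus the symmetries form a group.\<close>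

definition torus_symmetric :: "(real \<times> real) set \<Rightarrow> (real \<times> real) set \<Rightarrow> bool" where
  "torus_symmetric P Q \<longleftrightarrow> (\<exists>f. torus_symmetry f \<and> f ` torus_proj ` P = torus_proj ` Q)"

end

theory Submission
  imports Defs
begin

text \<open>
  After scaling by \<open>n\<close>, the lattice is \<open>L = {(x, y). y \<equiv> q x (mod n)}\<close>.  If \<open>u = (u1, u2)\<close> and
  \<open>v = (v1, -v2)\<close> form a basis of \<open>L\<close> with \<open>u1, u2, v1, v2 > 0\<close>, then
  \<open>(0, u1 + v1) \<times> (-v2, u2)\<close> contains no lattice point, so dispersion \<open>2/n\<close> gives
  \<open>(u1 + v1) (u2 + v2) \<le> 2n = 2 (u1 v2 + u2 v1)\<close>, that is, \<open>(u1 - v1) (u2 - v2) \<le> 0\<close>.  Start from the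
  basis \<open>(1, q), (1, q - n)\<close> and repeatedly replace the vector of larger height by \<open>u + v\<close>: this is
  the subtractive Euclidean algorithm on the heights \<open>q, n - q\<close>.  The new vector is the wider one,
  so it cannot be the higher one; hence all quotients are minimal and \<open>q, n - q\<close> are \<open>d\<close> times
  consecutive Fibonacci numbers.  Finally, all heights are multiples of \<open>d\<close>, and the
  empty strip of height \<open>d/n\<close> forces \<open>d \<le> 2\<close>.
\<close>

section \<open>Periodic rectangles\<close>

lemma torus_proj_idem [simp]: "torus_proj (torus_proj z) = torus_proj z"
  by (simp add: torus_proj_def)

text \<open>A set open in the quotient topology pulls back to an open set of the plane, so a small
  ball around \<open>z\<close> maps into the image of \<open>X \<times> Y\<close>. Moving one
  coordinate at a time splits this into two conditions on the circle.\<close>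

lemma torus_interiorD:
  assumes "z \<in> torus_interior (X \<times> Y)"
  shows "\<exists>e>0. \<forall>t. \<bar>t\<bar> < e \<longrightarrow> frac (fst z + t) \<in> frac ` X \<and> frac (snd z + t) \<in> frac ` Y"
proof -
  obtain T where T: "openin torus_topology T" "z \<in> T" "T \<subseteq> torus_proj ` (X \<times> Y)"
    using assms by (auto simp: torus_interior_def interior_of_def)
  have "open (torus_proj -` T)" and sub: "T \<subseteq> range torus_proj"
    using T(1) by (auto simp: openin_torus_topology)
  moreover have "torus_proj z = z"
    using T(2) sub by auto
  then have "z \<in> torus_proj -` T"
    using T(2) by simp
  ultimately obtain e where e: "e > 0" "ball z e \<subseteq> torus_proj -` T"
    using open_contains_ball by blast
  have mem: "torus_proj w \<in> torus_proj ` (X \<times> Y)" if "dist z w < e" for w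
  proof -
    have "w \<in> ball z e" using that by simp
    then show ?thesis using e(2) T(3) by blast
  qed
  have "frac (fst z + t) \<in> frac ` X \<and> frac (snd z + t) \<in> frac ` Y" if "\<bar>t\<bar> < e" for t
  proof -
    have "dist z (fst z + t, snd z) < e" "dist z (fst z, snd z + t) < e"
      using that by (cases z; simp add: dist_Pair_Pair dist_real_def)+
    from mem[OF this(1)] mem[OF this(2)] show ?thesis
      by (auto simp: torus_proj_def)
  qed
  with e(1) show ?thesis by blast
qed

lemma frac_eq_self: "0 \<le> x \<Longrightarrow> x < 1 \<Longrightarrow> frac x = x" for x :: real
  by (simp add: frac_eq)

text \<open>At an endpoint a small step leaves the arc: from 0 a step to the left wraps round to
  just below 1, which lies beyond \<open>w\<close>.\<close>

lemma interior_initial_interval: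
  fixes z w e :: real
  assumes "0 \<le> z" "z < 1" "w < 1" "e > 0"
    and near: "\<And>t. \<bar>t\<bar> < e \<Longrightarrow> frac (z + t) \<in> frac ` {0..w}"
  shows "0 < z" "z < w"
proof -
  have img: "frac ` {0..w} = {0..w}"
    using assms(3) by (force simp: frac_eq_self image_def)
  show "0 < z"
  proof (rule ccontr)
    assume "\<not> 0 < z"
    then have z: "z = 0" using assms by simp
    define s where "s = min (e / 2) ((1 - w) / 2)"
    have s: "0 < s" "s < e" "s < 1 - w"
      using assms by (auto simp: s_def min_def)
    show False
    \<comment> \<open>\<open>1 \<le> s\<close> forces \<open>w\<close> to be negative; then
      \<open>{0..w}\<close> is empty and the step \<open>t = 0\<close> already contradicts
      \<open>near\<close>.\<close>
    proof (cases "s < 1")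
      case True
      have "frac (- s) = 1 - s"
        using s True by (simp add: frac_unique_iff)
      with near[of "-s"] s z show False by (simp add: img)
    next
      case False
      with near[of 0] s z assms show False by (simp add: img)
    qed
  qed
  show "z < w"
  proof (rule ccontr)
    assume "\<not> z < w"
    define s where "s = min (e / 2) ((1 - z) / 2)"
    have s: "0 < s" "s < e" "s < 1 - z"
      using assms by (auto simp: s_def min_def)
    have "frac (z + s) = z + s"
      using s assms by (simp add: frac_eq_self)
    with near[of s] s \<open>\<not> z < w\<close> show False by (simp add: img)
  qed
qed

lemma interior_wrapped_interval:
  fixes z u v e :: real
  assumes "0 \<le> z" "z < 1" "u > 0" "v > 0" "u + v < 1" "e > 0"
    and near: "\<And>t. \<bar>t\<bar> < e \<Longrightarrow> frac (z + t) \<in> frac ` ({0..u} \<union> {1 - v..1})"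
  shows "z < u \<or> 1 - v < z"
proof (rule ccontr)
  have img: "x \<le> u \<or> 1 - v \<le> x" if x: "x \<in> frac ` ({0..u} \<union> {1 - v..1})" for x
  proof -
    obtain y where y: "x = frac y" "y \<in> {0..u} \<union> {1 - v..1}"
      using x by blast
    show ?thesis
    proof (cases "y = 1")
      case True
      then show ?thesis using y assms by simp
    next
      case False
      then have "frac y = y" using y assms by (auto simp: frac_eq_self)
      then show ?thesis using y by auto
    qed
  qed
  assume "\<not> ?thesis"
  then have z: "u \<le> z" "z \<le> 1 - v" by auto
  show False
  \<comment> \<open>From \<open>z\<close> in the closed gap \<open>{u..1 - v}\<close> a small step
    reaches the open gap: to the right, or to the left if \<open>z = 1 - v\<close>.\<close>
  proof (cases "z < 1 - v")
    case True
    define s where "s = min (e / 2) ((1 - v - z) / 2)"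
    have s: "0 < s" "s < e" "s < 1 - v - z"
      using assms True by (auto simp: s_def min_def)
    have "frac (z + s) = z + s"
      using s assms by (simp add: frac_eq_self)
    with img[OF near[of s]] s z show False by simp
  next
    case False
    define s where "s = min (e / 2) ((1 - v - u) / 2)"
    have s: "0 < s" "s < e" "s < 1 - v - u"
      using assms by (auto simp: s_def min_def)
    have "frac (z - s) = z - s"
      using s z False assms by (simp add: frac_eq_self)
    with img[OF near[of "- s"]] s z False show False by simp
  qed
qed

lemma periodic_interval_borel: "periodic_interval a b \<in> sets borel"
  by (simp add: periodic_interval_def)

lemma measure_periodic_rectangle:
  "measure lborel (periodic_rectangle x y) =
     measure lborel (periodic_interval (fst x) (fst y)) *
     measure lborel (periodic_interval (snd x) (snd y))"
proof -
  have "emeasure lborel (periodic_rectangle x y) =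
      emeasure lborel (periodic_interval (fst x) (fst y)) *
      emeasure lborel (periodic_interval (snd x) (snd y))"
    unfolding periodic_rectangle_def lborel_prod[symmetric]
    by (intro lborel.emeasure_pair_measure_Times) (simp_all add: periodic_interval_borel)
  then show ?thesis
    by (simp add: measure_def enn2real_mult)
qed

lemma measure_periodic_interval_le_1:
  assumes "a \<in> {0..1}" "b \<in> {0..1}"
  shows "measure lborel (periodic_interval a b) \<le> 1"
proof -
  have "periodic_interval a b \<subseteq> {0..1}"
    using assms by (auto simp: periodic_interval_def)
  then have "measure lborel (periodic_interval a b) \<le> measure lborel {0..1::real}"
    by (intro measure_mono_fmeasurable) (auto simp: periodic_interval_borel fmeasurable_def)
  then show ?thesis by simp
qed

text \<open>A real \<open>Sup\<close> dominates the members of a set that is bounded above; here the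
  area 1 of the unit square is a bound.\<close>

lemma measure_empty_rectangle_le_dispersion:
  assumes "x \<in> {0..1} \<times> {0..1}" "y \<in> {0..1} \<times> {0..1}"
    and "torus_interior (periodic_rectangle x y) \<inter> torus_proj ` P = {}"
  shows "measure lborel (periodic_rectangle x y) \<le> dispersion P"
  unfolding dispersion_def
proof (rule cSup_upper)
  show "bdd_above {measure lborel (periodic_rectangle x y) | x y.
     x \<in> {0..1} \<times> {0..1} \<and> y \<in> {0..1} \<times> {0..1} \<and>
     torus_interior (periodic_rectangle x y) \<inter> torus_proj ` P = {}}"
  proof (rule bdd_aboveI[where M = 1], clarify)
    fix a b c d :: real
    assume "a \<in> {0..1}" "b \<in> {0..1}" "c \<in> {0..1}" "d \<in> {0..1}"
    then show "measure lborel (periodic_rectangle (a, b) (c, d)) \<le> 1"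
      by (simp only: measure_periodic_rectangle fst_conv snd_conv)
        (intro mult_le_one measure_periodic_interval_le_1 measure_nonneg; assumption)
  qed
qed (use assms in blast)

section \<open>Empty boxes of an integration lattice\<close>

lemma frac_of_nat_div: "frac (real a / real n) = real (a mod n) / real n" if "n > 0"
proof -
  have "real a = real n * real (a div n) + real (a mod n)"
    by (metis mult_div_mod_eq of_nat_add of_nat_mult)
  then have "real a / real n - real (a mod n) / real n = of_int (int (a div n))"
    using that by (simp add: field_simps)
  then have "real a / real n - real (a mod n) / real n \<in> \<int>"
    by (metis Ints_of_int)
  then show ?thesis
    using that by (simp add: frac_unique_iff)
qed

lemma torus_proj_integration_lattice:
  assumes "n > 0"
  shows "torus_proj ` integration_lattice n q = integration_lattice n q"
proof -
  have "torus_proj z = z" if "z \<in> integration_lattice n q" for z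
    using that by (auto simp: integration_lattice_def torus_proj_def intro!: frac_eq_self)
  then show ?thesis by simp
qed

text \<open>Since \<open>n\<close> is the absolute determinant of \<open>u = (u1, u2)\<close> and
  \<open>v = (v1, - v2)\<close>, these span the lattice, so \<open>(x, y) = i u + j v\<close> with
  integers \<open>i\<close>, \<open>j\<close>.\<close>

lemma no_lattice_point_in_box:
  fixes n q u1 u2 v1 v2 x y :: int
  assumes pos: "u1 > 0" "u2 > 0" "v1 > 0" "v2 > 0"
    and n: "n = u1 * v2 + u2 * v1"
    and L: "n dvd u1 * q - u2" "n dvd v1 * q + v2" "n dvd x * q - y"
    and box: "0 < x" "x < u1 + v1" "- v2 < y" "y < u2"
  shows False
proof -
  have "n > 0" using pos n by (simp add: add_pos_pos)
  txt \<open>Cramer's rule for \<open>(x, y) = i u + j v\<close>.\<close>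
  have "x * v2 + y * v1 = x * (v1 * q + v2) - v1 * (x * q - y)"
    by (simp add: algebra_simps)
  then obtain i where i: "x * v2 + y * v1 = n * i"
    using L by (metis dvd_def dvd_diff dvd_mult)
  have "x * u2 - y * u1 = u1 * (x * q - y) - x * (u1 * q - u2)"
    by (simp add: algebra_simps)
  then obtain j where j: "x * u2 - y * u1 = n * j"
    using L by (metis dvd_def dvd_diff dvd_mult)
  have "n * x = u1 * (x * v2 + y * v1) + v1 * (x * u2 - y * u1)"
    unfolding n by (simp add: algebra_simps)
  also have "\<dots> = n * (u1 * i + v1 * j)"
    unfolding i j by (simp add: algebra_simps)
  finally have "n * x = n * (u1 * i + v1 * j)" .
  then have x: "x = u1 * i + v1 * j" using \<open>n > 0\<close> by simp
  have "n * y = u2 * (x * v2 + y * v1) - v2 * (x * u2 - y * u1)"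
    unfolding n by (simp add: algebra_simps)
  also have "\<dots> = n * (u2 * i - v2 * j)"
    unfolding i j by (simp add: algebra_simps)
  finally have "n * y = n * (u2 * i - v2 * j)" .
  then have y: "y = u2 * i - v2 * j" using \<open>n > 0\<close> by simp
  have ge: "a * k \<ge> a" if "a > 0" "k \<ge> 1" for a k :: int
    using that by simp
  have le: "a * k \<le> 0" if "a > 0" "k \<le> 0" for a k :: int
    using that by (simp add: mult_le_0_iff)
  \<comment> \<open>Both coefficients positive give \<open>x \<ge> u1 + v1\<close>, both at most 0
    give \<open>x \<le> 0\<close>; the mixed cases give \<open>y \<ge> u2\<close> and
    \<open>y \<le> - v2\<close>.\<close>
  consider "i \<ge> 1" "j \<ge> 1" | "i \<le> 0" "j \<le> 0" | "i \<ge> 1" "j \<le> 0" | "i \<le> 0" "j \<ge> 1"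
    by linarith
  then show False
  proof cases
    case 1
    then show ?thesis using ge[OF pos(1)] ge[OF pos(3)] x box by fastforce
  next
    case 2
    then show ?thesis using le[OF pos(1)] le[OF pos(3)] x box by fastforce
  next
    case 3
    then show ?thesis using ge[OF pos(2)] le[OF pos(4)] y box by fastforce
  next
    case 4
    then show ?thesis using le[OF pos(2)] ge[OF pos(4)] y box by fastforce
  qed
qed

text \<open>Divided by \<open>n\<close>, the box \<open>(0, u1 + v1) \<times> (- v2, u2)\<close>
  becomes a periodic rectangle whose second side wraps through 0. The bounds \<open>small\<close>
  keep both sides shorter than the circle.\<close>

lemma empty_box_le_dispersion:
  fixes n q :: nat and u1 u2 v1 v2 :: int
  assumes pos: "u1 > 0" "u2 > 0" "v1 > 0" "v2 > 0"
    and n: "int n = u1 * v2 + u2 * v1"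
    and L: "int n dvd u1 * int q - u2" "int n dvd v1 * int q + v2"
    and small: "u1 + v1 < int n" "u2 + v2 < int n"
  shows "real_of_int (u1 + v1) / n * (real_of_int (u2 + v2) / n) \<le>
    dispersion (integration_lattice n q)"
proof -
  have n0: "0 < n" using pos small by linarith
  define w where "w = real_of_int (u1 + v1) / n"
  define c where "c = real_of_int u2 / n"
  define b where "b = real_of_int v2 / n"
  have w: "0 < w" "w < 1" and cb: "0 < c" "0 < b" "c + b < 1"
    using pos small n0 by (auto simp: w_def c_def b_def field_simps)
  have X: "periodic_interval 0 w = {0..w}"
    and Y: "periodic_interval (1 - b) c = {0..c} \<union> {1 - b..1}"
    using w cb by (auto simp: periodic_interval_def)
  have empty: "torus_interior (periodic_rectangle (0, 1 - b) (w, c)) \<inter>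
      torus_proj ` integration_lattice n q = {}"
  proof (rule ccontr)
    assume "\<not> ?thesis"
    then obtain z where z: "z \<in> torus_interior ({0..w} \<times> ({0..c} \<union> {1 - b..1}))"
      and "z \<in> integration_lattice n q"
      using torus_proj_integration_lattice[OF n0] by (auto simp: periodic_rectangle_def X Y)
    then obtain k where k: "k < n" and zk: "z = (real k / n, real (k * q mod n) / n)"
      by (auto simp: integration_lattice_def frac_of_nat_div[OF n0] simp del: of_nat_mult)
    obtain e where "e > 0" and
      e1: "\<And>t. \<bar>t\<bar> < e \<Longrightarrow> frac (real k / n + t) \<in> frac ` {0..w}" and
      e2: "\<And>t. \<bar>t\<bar> < e \<Longrightarrow>
        frac (real (k * q mod n) / n + t) \<in> frac ` ({0..c} \<union> {1 - b..1})"
      using torus_interiorD[OF z] unfolding zk fst_conv snd_conv by blast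
    have "0 \<le> real k / n" "real k / n < 1"
      using k by auto
    from interior_initial_interval[OF this w(2) \<open>e > 0\<close> e1]
    have "0 < real k / n" "real k / n < w"
      by blast+
    then have x: "0 < int k" "int k < u1 + v1"
      using n0 by (auto simp: w_def divide_less_cancel zero_less_divide_iff)
    have kq: "k * q mod n < n" using n0 by simp
    then have "0 \<le> real (k * q mod n) / n" "real (k * q mod n) / n < 1"
      using n0 by auto
    from interior_wrapped_interval[OF this cb \<open>e > 0\<close> e2]
    have "real (k * q mod n) / n < c \<or> 1 - b < real (k * q mod n) / n"
      by blast
    \<comment> \<open>A residue in the arc above \<open>1 - b\<close> represents the negative height
      obtained by subtracting \<open>n\<close>.\<close>
    then have y: "int (k * q mod n) < u2 \<or> - v2 < int (k * q mod n) - int n"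
      using n0 by (auto simp: c_def b_def divide_less_cancel field_simps)
    have dvd: "int n dvd int k * int q - int (k * q mod n)"
      by (metis mod_eq_dvd_iff mod_mod_trivial of_nat_mod of_nat_mult)
    then have dvd': "int n dvd int k * int q - (int (k * q mod n) - int n)"
      by (simp add: algebra_simps) (metis add.commute add_diff_eq dvd_add_triv_left_iff)
    from y show False
    proof
      assume "int (k * q mod n) < u2"
      moreover have "- v2 < int (k * q mod n)" using pos by linarith
      ultimately show False
        using no_lattice_point_in_box[OF pos n L dvd x] by blast
    next
      assume "- v2 < int (k * q mod n) - int n"
      moreover have "int (k * q mod n) - int n < u2" using pos kq by linarith
      ultimately show False
        using no_lattice_point_in_box[OF pos n L dvd' x] by blast
    qed
  qed
  have "measure lborel ({0..c} \<union> {1 - b..1}) = measure lborel {0..c} + measure lborel {1 - b..1}"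
    using cb by (intro measure_Union) auto
  then have "measure lborel (periodic_rectangle (0, 1 - b) (w, c)) = w * (c + b)"
    using w cb by (simp add: measure_periodic_rectangle X Y)
  moreover have "measure lborel (periodic_rectangle (0, 1 - b) (w, c)) \<le>
      dispersion (integration_lattice n q)"
    using w cb by (intro measure_empty_rectangle_le_dispersion empty) auto
  ultimately show ?thesis
    by (simp add: w_def c_def b_def add_divide_distrib)
qed

text \<open>All heights \<open>k * q mod n\<close> are multiples of \<open>d\<close>, so none lies
  strictly between 0 and \<open>d\<close>, and the strip can run once around the torus.\<close>

lemma empty_strip_le_dispersion:
  fixes n q d :: nat
  assumes d: "0 < d" "d < n" "d dvd n" "d dvd q"
  shows "real d / n \<le> dispersion (integration_lattice n q)"
proof -
  have n0: "0 < n" using d by simp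
  define w where "w = real d / n"
  have w: "0 < w" "w < 1" using d by (auto simp: w_def)
  have X: "periodic_interval 0 1 = {0..1}" and Y: "periodic_interval 0 w = {0..w}"
    using w by (auto simp: periodic_interval_def)
  have empty: "torus_interior (periodic_rectangle (0, 0) (1, w)) \<inter>
      torus_proj ` integration_lattice n q = {}"
  proof (rule ccontr)
    assume "\<not> ?thesis"
    then obtain z where z: "z \<in> torus_interior ({0..1} \<times> {0..w})"
      and "z \<in> integration_lattice n q"
      using torus_proj_integration_lattice[OF n0] by (auto simp: periodic_rectangle_def X Y)
    then obtain k where zk: "z = (real k / n, real (k * q mod n) / n)"
      by (auto simp: integration_lattice_def frac_of_nat_div[OF n0] simp del: of_nat_mult)
    obtain e where "e > 0" and
      e: "\<And>t. \<bar>t\<bar> < e \<Longrightarrow> frac (real (k * q mod n) / n + t) \<in> frac ` {0..w}"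
      using torus_interiorD[OF z] unfolding zk fst_conv snd_conv by blast
    have "0 \<le> real (k * q mod n) / n" "real (k * q mod n) / n < 1"
      using n0 by auto
    from interior_initial_interval[OF this w(2) \<open>e > 0\<close> e]
    have "0 < real (k * q mod n) / n" "real (k * q mod n) / n < w"
      by blast+
    then have "0 < k * q mod n" "k * q mod n < d"
      using n0 by (auto simp: w_def divide_less_cancel intro: gr0I)
    moreover have "d dvd k * q mod n" using d by (simp add: dvd_mod)
    ultimately show False by (auto dest: dvd_imp_le)
  qed
  have "measure lborel (periodic_rectangle (0, 0) (1, w)) = w"
    using w by (simp add: measure_periodic_rectangle X Y)
  moreover have "measure lborel (periodic_rectangle (0, 0) (1, w)) \<le>
      dispersion (integration_lattice n q)"
    using w by (intro measure_empty_rectangle_le_dispersion empty) auto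
  ultimately show ?thesis by (simp add: w_def)
qed

section \<open>The Euclidean algorithm and Fibonacci numbers\<close>

text \<open>Strong induction on \<open>u2 + v2\<close> along the subtractive Euclidean algorithm.
  The bound \<open>u2 + v2 \<le> n\<close> is not strict, so as to admit the starting basis; the sum
  drops strictly at every step.\<close>

lemma basis_heights_fib:
  fixes n q :: nat and u1 u2 v1 v2 :: int
  assumes disp: "dispersion (integration_lattice n q) \<le> 2 / n"
    and "u1 > 0" "u2 > 0" "v1 > 0" "v2 > 0"
    and "int n = u1 * v2 + u2 * v1"
    and "int n dvd u1 * int q - u2" "int n dvd v1 * int q + v2"
    and "u2 + v2 \<le> int n"
  shows "\<exists>k\<ge>1. \<exists>d>0. (u2 = int (d * fib k) \<and> v2 = int (d * fib (k + 1))) \<or>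
    (v2 = int (d * fib k) \<and> u2 = int (d * fib (k + 1)))"
  using assms(2-)
proof (induction "nat (u2 + v2)" arbitrary: u1 u2 v1 v2 rule: less_induct)
  case less
  note pos = less.prems(1-4) and n = less.prems(5) and L = less.prems(6,7)
  \<comment> \<open>The empty box gives \<open>(x1 + y1) * (x2 + y2) \<le> 2 * n\<close>; inserting
    \<open>n = x1 * y2 + x2 * y1\<close> leaves this product.\<close>
  have bound: "(x1 - y1) * (x2 - y2) \<le> 0"
    if xy: "x1 > 0" "x2 > 0" "y1 > 0" "y2 > 0" "int n = x1 * y2 + x2 * y1"
      "int n dvd x1 * int q - x2" "int n dvd y1 * int q + y2" "x2 + y2 < int n"
    for x1 x2 y1 y2 :: int
  proof (cases "x2 = y2")
    case False
    \<comment> \<open>Two heights equal to 1 would give \<open>x1 + y1 = n\<close>, a box as wide as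
      the torus. Unequal heights include one that is at least 2, which makes the inequality
      strict.\<close>
    have "x1 + y1 < int n"
    proof -
      have "x1 * 1 \<le> x1 * y2" "1 * y1 \<le> x2 * y1"
        using xy by (intro mult_left_mono mult_right_mono; simp)+
      moreover have "x1 * 2 \<le> x1 * y2 \<or> 2 * y1 \<le> x2 * y1"
      proof (cases "y2 \<ge> 2")
        case True
        then show ?thesis using xy by (intro disjI1 mult_left_mono) auto
      next
        case y2: False
        then have "x2 \<ge> 2" using xy False by linarith
        then show ?thesis using xy by (intro disjI2 mult_right_mono) auto
      qed
      ultimately show ?thesis using xy(1,3,5) by linarith
    qed
    then have "real_of_int (x1 + y1) / n * (real_of_int (x2 + y2) / n) \<le> 2 / n"
      using empty_box_le_dispersion[OF xy(1-7) _ xy(8)] disp by linarith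
    moreover have "0 < real n" using xy by simp
    ultimately have "real_of_int (x1 + y1) * real_of_int (x2 + y2) \<le> 2 * real n"
      by (simp add: divide_le_cancel pos_divide_le_eq)
    then have "real_of_int ((x1 + y1) * (x2 + y2)) \<le> real_of_int (2 * int n)"
      by simp
    then have "(x1 + y1) * (x2 + y2) \<le> 2 * int n"
      by linarith
    then show ?thesis unfolding xy(5) by (simp add: algebra_simps)
  qed simp
  consider "u2 = v2" | "v2 < u2" | "u2 < v2" by linarith
  then show ?case
  proof cases
    case 1
    \<comment> \<open>Equal heights fit because \<open>fib 1 = fib 2\<close>, with \<open>d\<close>
      the common height.\<close>
    then show ?thesis using pos by (intro exI[of _ 1] conjI exI[of _ "nat u2"]) auto
  next
    case 2
    have n': "int n = (u1 + v1) * v2 + (u2 - v2) * v1"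
      using n by (simp add: algebra_simps)
    have L': "int n dvd (u1 + v1) * int q - (u2 - v2)"
      using dvd_add[OF L] by (simp add: algebra_simps)
    \<comment> \<open>\<open>u + v\<close> replaces \<open>u\<close>. It is strictly wider than
      \<open>v\<close>, so \<open>bound\<close> forbids it to be higher.\<close>
    have "(u1 + v1 - v1) * (u2 - v2 - v2) \<le> 0"
      by (rule bound) (use 2 pos n' L' L less.prems(8) in auto)
    then have le: "u2 - v2 \<le> v2"
      using pos by (simp add: mult_le_0_iff)
    have "\<exists>k\<ge>1. \<exists>d>0. (u2 - v2 = int (d * fib k) \<and> v2 = int (d * fib (k + 1))) \<or>
        (v2 = int (d * fib k) \<and> u2 - v2 = int (d * fib (k + 1)))"
      by (rule less.hyps[of _ _ "u1 + v1" v1]) (use 2 pos n' L' L less.prems(8) in auto)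
    then obtain k d where kd: "k \<ge> 1" "d > 0"
      "(u2 - v2 = int (d * fib k) \<and> v2 = int (d * fib (k + 1))) \<or>
        (v2 = int (d * fib k) \<and> u2 - v2 = int (d * fib (k + 1)))" by blast
    \<comment> \<open>In the reversed alternative, monotonicity and \<open>le\<close> force equal
      heights, so the stated order holds in both.\<close>
    have "d * fib k \<le> d * fib (k + 1)" by (simp add: fib_mono)
    with kd(3) le have "u2 - v2 = int (d * fib k)" "v2 = int (d * fib (k + 1))" by linarith+
    then have "v2 = int (d * fib (k + 1))" "u2 = int (d * fib (k + 1 + 1))"
      by (auto simp: algebra_simps)
    moreover have "k + 1 \<ge> 1" by simp
    ultimately show ?thesis using kd(2) by blast
  next
    case 3
    have n': "int n = u1 * (v2 - u2) + u2 * (u1 + v1)"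
      using n by (simp add: algebra_simps)
    have L': "int n dvd (u1 + v1) * int q + (v2 - u2)"
      using dvd_add[OF L] by (simp add: algebra_simps)
    \<comment> \<open>Mirror image: \<open>u + v\<close> replaces \<open>v\<close> and is strictly
      wider than \<open>u\<close>.\<close>
    have "(u1 - (u1 + v1)) * (u2 - (v2 - u2)) \<le> 0"
      by (rule bound) (use 3 pos n' L' L less.prems(8) in auto)
    then have le: "v2 - u2 \<le> u2"
      using pos by (simp add: zero_le_mult_iff)
    have "\<exists>k\<ge>1. \<exists>d>0. (u2 = int (d * fib k) \<and> v2 - u2 = int (d * fib (k + 1))) \<or>
        (v2 - u2 = int (d * fib k) \<and> u2 = int (d * fib (k + 1)))"
      by (rule less.hyps[of _ _ u1 "u1 + v1"]) (use 3 pos n' L' L less.prems(8) in auto)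
    then obtain k d where kd: "k \<ge> 1" "d > 0"
      "(u2 = int (d * fib k) \<and> v2 - u2 = int (d * fib (k + 1))) \<or>
        (v2 - u2 = int (d * fib k) \<and> u2 = int (d * fib (k + 1)))" by blast
    have "d * fib k \<le> d * fib (k + 1)" by (simp add: fib_mono)
    with kd(3) le have "v2 - u2 = int (d * fib k)" "u2 = int (d * fib (k + 1))" by linarith+
    then have "u2 = int (d * fib (k + 1))" "v2 = int (d * fib (k + 1 + 1))"
      by (auto simp: algebra_simps)
    moreover have "k + 1 \<ge> 1" by simp
    ultimately show ?thesis using kd(2) by blast
  qed
qed

section \<open>Symmetries of the torus\<close>

text \<open>The identity of the torus arises as the translation by 0.\<close>

lemma torus_symmetric_refl: "torus_symmetric P P"
proof -
  have "(\<lambda>(x1, x2). torus_proj (x1 + 0, x2 + 0)) ` torus_proj ` P = torus_proj ` P"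
    by (force simp: image_image case_prod_unfold)
  then show ?thesis
    unfolding torus_symmetric_def using torus_symmetry.translation by blast
qed

text \<open>Reflecting the second coordinate negates heights modulo \<open>n\<close>, and
  \<open>- k q\<close> is congruent to \<open>k (n - q)\<close>.\<close>

lemma torus_symmetric_reflected_generator:
  assumes "q \<le> n" "0 < n"
  shows "torus_symmetric (integration_lattice n q) (integration_lattice n (n - q))"
proof -
  have "frac (1 - frac (real (k * q) / n)) = frac (real (k * (n - q)) / n)" for k
  proof -
    have "1 - frac (real (k * q) / n) =
        real (k * (n - q)) / n + of_int (1 - int k + \<lfloor>real (k * q) / n\<rfloor>)"
      using assms by (simp add: frac_def of_nat_diff field_simps)
    then show ?thesis
      by (metis frac_add_of_int_right)
  qed
  moreover have "frac (real k / n) = real k / n" if "k < n" for k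
    using that by (intro frac_eq_self) auto
  ultimately have "(\<lambda>(x1, x2). torus_proj (x1, 1 - x2)) ` integration_lattice n q =
      integration_lattice n (n - q)"
    unfolding integration_lattice_def image_image
    by (intro image_cong) (auto simp: torus_proj_def)
  then show ?thesis
    unfolding torus_symmetric_def torus_proj_integration_lattice[OF assms(2)]
    using torus_symmetry.reflection_snd by blast
qed

theorem theorem3:
  fixes n q :: nat
  assumes "n \<ge> 2" and "1 \<le> q" and "q < n"
    and "dispersion (integration_lattice n q) = 2 / real n"
  shows "\<exists>m\<ge>3.
    (n = fib m \<and> torus_symmetric (integration_lattice n q) (fibonacci_lattice m)) \<or>
    (n = 2 * fib m \<and>
      torus_symmetric (integration_lattice n q) (integration_lattice n (2 * fib (m - 2))))"
proof -
  have "\<exists>k\<ge>1. \<exists>d>0. (int q = int (d * fib k) \<and> int n - int q = int (d * fib (k + 1))) \<or>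
    (int n - int q = int (d * fib k) \<and> int q = int (d * fib (k + 1)))"
    \<comment> \<open>The starting basis is \<open>(1, q)\<close> and \<open>(1, q - n)\<close>,
      with heights \<open>q\<close> and \<open>n - q\<close>.\<close>
    by (rule basis_heights_fib[of n q 1 _ 1]) (use assms in auto)
  then obtain k d where k: "k \<ge> 1" and d: "d > 0"
    and kd: "(int q = int (d * fib k) \<and> int n - int q = int (d * fib (k + 1))) \<or>
      (int n - int q = int (d * fib k) \<and> int q = int (d * fib (k + 1)))" by blast
  have n: "n = d * fib (k + 2)"
  proof -
    have "int n = int (d * fib k) + int (d * fib (k + 1))" using kd by linarith
    then have "n = d * fib k + d * fib (k + 1)" by linarith
    then show ?thesis by (simp add: algebra_simps)
  qed
  have q: "q = d * fib k \<or> n - q = d * fib k"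
    using kd by linarith
  have "d dvd q" using kd by (metis dvd_triv_left of_nat_eq_iff)
  have "d dvd n" using n by simp
  have "d < n" using \<open>d dvd q\<close> assms by (auto dest: dvd_imp_le)
  \<comment> \<open>The common factor \<open>d\<close> of \<open>n\<close> and \<open>q\<close>
    leaves an empty strip of area \<open>d / n\<close>.\<close>
  then have "real d / n \<le> 2 / n"
    using empty_strip_le_dispersion[OF d _ _ \<open>d dvd q\<close>] \<open>d dvd n\<close> assms(4) by metis
  then have "d \<le> 2" using assms(1) by (simp add: divide_le_cancel)
  \<comment> \<open>If \<open>n - q\<close> rather than \<open>q\<close> is the smaller multiple
    \<open>d * fib k\<close>, a reflection exchanges the two generators.\<close>
  have sym: "torus_symmetric (integration_lattice n q) (integration_lattice n (d * fib k))"
    using q torus_symmetric_refl torus_symmetric_reflected_generator[of q n] assms by auto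
  consider "d = 1" | "d = 2" using d \<open>d \<le> 2\<close> by linarith
  then show ?thesis
  proof cases
    case 1
    then show ?thesis using k n sym
      by (intro exI[of _ "k + 2"]) (simp add: fibonacci_lattice_def)
  next
    case 2
    then show ?thesis using k n sym by (intro exI[of _ "k + 2"]) simp
  qed
qed

end
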